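(* Let $m\ge 1$ and $n\ge 2$ be integers, let $M=\{1,\dots,m\}$ be a set of items and $N=\{1,\dots,n\}$ a set of agents with linear valuations given by numbers $v_{\ell i}\ge 0$ ($\ell\in M$, $i\in N$). For $y=(y_{\ell i})\in\mathbb{R}^{mn}$ with rows $y_\ell=(y_{\ell 1},\dots,y_{\ell n})\in\mathbb{R}^n$, let $$h(y_\ell)=\max_{r\in N}y_{\ell r}\quad(\ell\in M),\qquad A_{kj}(y)=\max_{i\in N,\ i\neq j}\ \sum_{\ell\in M,\ \ell\neq k}\big(h(y_\ell+v_{\ell i}e_{ij})-h(y_\ell)\big)\quad(k\in M,\ j\in N),$$ where $e_{ij}=e_j-e_i$ and $e_1,\dots,e_n$ is the standard basis of $\mathbb{R}^n$. Let $T:\mathbb{R}^{mn}\to\mathbb{R}^{mn}$ be the map whose $(k,j)$-th coordinate is $$T_{kj}(y)=\min\{\,y_{kj},\ h(y_k)-A_{kj}(y)\,\}.$$ Then an EFX allocation exists if and only if $T$ has a fixed point, i.e. there is $y^*\in\mathbb{R}^{mn}$ with $T(y^* )=y^*$.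
   Context: Linear valuations: agent $i$ values a set $S\subseteq M$ of items at $v_i(S)=\sum_{k\in S}v_{ki}$, where $v_{ki}\ge 0$ is the value agent $i$ assigns to item $k$. An EFX allocation (envy-free up to any good) is a partition $X=(X_1,\dots,X_n)$ of $M$ (pairwise disjoint, possibly empty sets with union $M$) such that $v_i(X_i)\ge v_i(X_j\setminus\{k\})$ for all $i,j\in N$ and all $k\in X_j$. *)

theory Defs
  imports "HOL-Analysis.Analysis"
begin

(* Items are the elements of the finite index type 'm and agents those of 'n.
   A matrix v :: real^'n^'m has the entry v $ l $ i for item l and agent i;
   its row v $ l lies in real^'n. *)

definition valuation :: "real^'n^'m \<Rightarrow> 'n \<Rightarrow> 'm set \<Rightarrow> real" where
  "valuation v i S = (\<Sum>k\<in>S. v $ k $ i)"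

definition allocation :: "('n \<Rightarrow> 'm set) \<Rightarrow> bool" where
  "allocation X \<longleftrightarrow> disjoint_family X \<and> (\<Union>i. X i) = UNIV"

definition EFX_allocation :: "real^'n^'m \<Rightarrow> ('n \<Rightarrow> 'm set) \<Rightarrow> bool" where
  "EFX_allocation v X \<longleftrightarrow> allocation X \<and>
     (\<forall>i j. \<forall>k\<in>X j. valuation v i (X i) \<ge> valuation v i (X j - {k}))"

definition h :: "real^'n \<Rightarrow> real" where
  "h z = (MAX r. z $ r)"

definition e :: "'n \<Rightarrow> 'n \<Rightarrow> real^'n" where
  "e i j = axis j 1 - axis i 1"

(* The outer maximum ranges over a nonempty set only if there are at least two agents. *)
definition A :: "real^'n^'m \<Rightarrow> real^'n^'m \<Rightarrow> 'm \<Rightarrow> 'n \<Rightarrow> real" where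
  "A v y k j = (MAX i\<in>{i. i \<noteq> j}.
     \<Sum>l\<in>{l. l \<noteq> k}. h (y $ l + (v $ l $ i) *\<^sub>R e i j) - h (y $ l))"

definition T :: "real^'n^'m \<Rightarrow> real^'n^'m \<Rightarrow> real^'n^'m" where
  "T v y = (\<chi> k j. min (y $ k $ j) (h (y $ k) - A v y k j))"

end

theory Submission
  imports Defs
begin

text \<open>
  Read a matrix \<open>y\<close> as a soft assignment in which item \<open>l\<close> belongs to an agent \<open>a l\<close> that maximises
  row \<open>l\<close>. Then \<open>h (y\<^sub>l + v\<^sub>l\<^sub>i e\<^sub>i\<^sub>j) - h y\<^sub>l\<close> is at least \<open>v\<^sub>l\<^sub>i ([a l = j] - [a l = i])\<close>, with equality
  when the maximum is attained with a large enough margin. Summed over \<open>l \<noteq> k\<close>, the right-hand side is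
  \<open>v\<^sub>i (X\<^sub>j - {k}) - v\<^sub>i (X\<^sub>i - {k})\<close>. The fixed-point condition at \<open>(k, j)\<close> with \<open>a k = j\<close> therefore
  forces the EFX inequality, and conversely an EFX allocation yields the fixed point whose
  row \<open>l\<close> is a large multiple of the unit vector of the owner of \<open>l\<close>.
\<close>

lemma nth_le_h: "z $ r \<le> h z"
  unfolding h_def by (rule Max_ge) auto

lemma h_le_iff: "h z \<le> c \<longleftrightarrow> (\<forall>r. z $ r \<le> c)"
  unfolding h_def by (subst Max_le_iff) auto

lemma h_attained: "\<exists>r. z $ r = h z"
proof -
  have "h z \<in> range (($) z)"
    unfolding h_def by (rule Max_in) auto
  then show ?thesis by auto
qed

lemma h_scaleR_axis:
  assumes "B \<ge> 0"
  shows "h (B *\<^sub>R axis a 1) = B"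
proof (rule antisym)
  show "h (B *\<^sub>R axis a 1) \<le> B"
    using assms by (auto simp: h_le_iff axis_def)
  show "B \<le> h (B *\<^sub>R axis a 1)"
    using nth_le_h[of "B *\<^sub>R axis a 1" a] by (simp add: axis_def)
qed

text \<open>The maximum of the shifted vector is at least its coordinate \<open>a\<close>, and the
  shift changes that coordinate by exactly
  \<open>t * (of_bool (a = j) - of_bool (a = i))\<close>.\<close>

lemma h_shift_ge:
  assumes "z $ a = h z"
  shows "t * (of_bool (a = j) - of_bool (a = i)) \<le> h (z + t *\<^sub>R e i j) - h z"
  using nth_le_h[of "z + t *\<^sub>R e i j" a] assms
  by (auto simp: e_def axis_def algebra_simps split: if_splits)

text \<open>The tight case is \<open>a = i\<close> with \<open>j\<close> different: coordinate
  \<open>a\<close> drops to \<open>B - t\<close> while coordinate \<open>j\<close> rises to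
  \<open>t\<close>. The factor 2 in the bound on \<open>B\<close> keeps \<open>a\<close>
  maximal.\<close>

lemma h_shift_axis_le:
  assumes "t \<ge> 0" "B \<ge> 2 * t"
  shows "h (B *\<^sub>R axis a 1 + t *\<^sub>R e i j) - h (B *\<^sub>R axis a 1)
    \<le> t * (of_bool (a = j) - of_bool (a = i))"
proof -
  have "h (B *\<^sub>R axis a 1 + t *\<^sub>R e i j) \<le> B + t * (of_bool (a = j) - of_bool (a = i))"
    using assms by (auto simp: h_le_iff e_def axis_def)
  then show ?thesis
    using assms by (simp add: h_scaleR_axis)
qed

lemma sum_owner_eq_valuation_diff:
  fixes v :: "real^'n^'m"
  shows "(\<Sum>l\<in>{l. l \<noteq> k}. v $ l $ i * (of_bool (a l = j) - of_bool (a l = i)))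
    = valuation v i ({l. a l = j} - {k}) - valuation v i ({l. a l = i} - {k})"
proof -
  have "(\<Sum>l\<in>{l. l \<noteq> k}. v $ l $ i * of_bool (a l = r)) = valuation v i ({l. a l = r} - {k})" for r
    unfolding valuation_def by (rule sum.mono_neutral_cong_right) auto
  then show ?thesis
    by (simp add: right_diff_distrib sum_subtractf)
qed

text \<open>A minimum equals its first argument iff that argument is at most the second, and a bound
  on the maximum \<open>A\<close> is a bound for each \<open>i\<close>. The second step needs an
  agent other than \<open>j\<close>, which the cardinality assumption supplies.\<close>

lemma T_fixed_point_iff:
  fixes v y :: "real^'n^'m"
  assumes "CARD('n) \<ge> 2"
  shows "T v y = y \<longleftrightarrow> (\<forall>k j i. i \<noteq> j \<longrightarrow>
    y $ k $ j + (\<Sum>l\<in>{l. l \<noteq> k}. h (y $ l + (v $ l $ i) *\<^sub>R e i j) - h (y $ l)) \<le> h (y $ k))"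
proof -
  have ne: "{i. i \<noteq> j} \<noteq> {}" for j :: 'n
  proof
    assume "{i. i \<noteq> j} = {}"
    then have "(UNIV :: 'n set) = {j}" by auto
    then have "CARD('n) = 1" by (metis card_1_singleton_iff One_nat_def)
    with assms show False by simp
  qed
  have A_le: "A v y k j \<le> c \<longleftrightarrow> (\<forall>i. i \<noteq> j \<longrightarrow>
      (\<Sum>l\<in>{l. l \<noteq> k}. h (y $ l + (v $ l $ i) *\<^sub>R e i j) - h (y $ l)) \<le> c)" for k j c
    unfolding A_def using ne[of j] by (subst Max_le_iff) auto
  have "T v y = y \<longleftrightarrow> (\<forall>k j. A v y k j \<le> h (y $ k) - y $ k $ j)"
    by (auto simp: T_def vec_eq_iff min_def le_diff_eq algebra_simps)
  then show ?thesis
    unfolding A_le by (simp add: le_diff_eq add.commute)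
qed

lemma valuation_mono:
  assumes "\<And>l i. v $ l $ i \<ge> 0" "S \<subseteq> S'"
  shows "valuation v i S \<le> valuation v i S'"
  unfolding valuation_def using assms by (intro sum_mono2) auto

text \<open>Owner sums over \<open>l \<noteq> k\<close> remove \<open>k\<close> from both bundles.
  Putting it back on the right only helps, by monotonicity, and the case where \<open>i\<close> owns
  \<open>k\<close> is monotonicity alone.\<close>

lemma EFX_allocation_ownerI:
  assumes nonneg: "\<And>l i. v $ l $ i \<ge> 0"
    and envy: "\<And>k i. i \<noteq> a k \<Longrightarrow>
      valuation v i ({l. a l = a k} - {k}) \<le> valuation v i ({l. a l = i} - {k})"
  shows "EFX_allocation v (\<lambda>j. {l. a l = j})"
  unfolding EFX_allocation_def
proof (intro conjI allI ballI)
  show "allocation (\<lambda>j. {l. a l = j})"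
    by (auto simp: allocation_def disjoint_family_on_def)
  fix i j k
  assume "k \<in> {l. a l = j}"
  then have "a k = j" by simp
  show "valuation v i ({l. a l = j} - {k}) \<le> valuation v i {l. a l = i}"
  proof (cases "i = j")
    case True
    then show ?thesis
      by (auto intro: valuation_mono nonneg)
  next
    case False
    with \<open>a k = j\<close> envy[of i k]
    have "valuation v i ({l. a l = j} - {k}) \<le> valuation v i ({l. a l = i} - {k})"
      by simp
    also have "\<dots> \<le> valuation v i {l. a l = i}"
      by (intro valuation_mono nonneg) auto
    finally show ?thesis .
  qed
qed

lemma allocation_owner:
  assumes "allocation X"
  obtains a where "X = (\<lambda>j. {l. a l = j})"
proof -
  from assms have ex: "\<exists>j. l \<in> X j" for l
    unfolding allocation_def by blast
  then obtain a where a: "\<And>l. l \<in> X (a l)" by metis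
  have "a l = j" if "l \<in> X j" for l j
    using assms a[of l] that unfolding allocation_def disjoint_family_on_def by blast
  with a have "X = (\<lambda>j. {l. a l = j})"
    by (intro ext) auto
  then show thesis by (rule that)
qed

theorem theorem4:
  fixes v :: "real^'n^'m"
  assumes "CARD('m) \<ge> 1" and "CARD('n) \<ge> 2"
    and "\<And>l i. v $ l $ i \<ge> 0"
  shows "(\<exists>X. EFX_allocation v X) \<longleftrightarrow> (\<exists>y. T v y = y)"
proof
  assume "\<exists>X. EFX_allocation v X"
  then obtain X where X: "EFX_allocation v X" ..
  then obtain a where a: "X = (\<lambda>j. {l. a l = j})"
    using allocation_owner unfolding EFX_allocation_def by blast
  \<comment> \<open>One constant for two purposes: it is at least twice every single value, as
    \<open>h_shift_axis_le\<close> requires, and at least the value of any bundle, which settles the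
    entries of non-owners.\<close>
  define B where "B = 2 * (\<Sum>i\<in>UNIV. valuation v i UNIV)"
  have val_nonneg: "0 \<le> valuation v i S" for i S
    unfolding valuation_def by (intro sum_nonneg assms(3))
  have B: "2 * valuation v i S \<le> B" for i S
  proof -
    have "valuation v i S \<le> valuation v i UNIV"
      by (intro valuation_mono assms(3)) auto
    also have "\<dots> \<le> (\<Sum>i\<in>UNIV. valuation v i UNIV)"
      by (rule member_le_sum) (auto intro: val_nonneg)
    finally show ?thesis unfolding B_def by simp
  qed
  have B_nonneg: "0 \<le> B"
    unfolding B_def by (intro mult_nonneg_nonneg sum_nonneg val_nonneg) simp
  define y :: "real^'n^'m" where "y = (\<chi> l. B *\<^sub>R axis (a l) 1)"
  have "y $ k $ j + (\<Sum>l\<in>{l. l \<noteq> k}. h (y $ l + (v $ l $ i) *\<^sub>R e i j) - h (y $ l)) \<le> h (y $ k)"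
    if "i \<noteq> j" for k i j
  proof -
    have "(\<Sum>l\<in>{l. l \<noteq> k}. h (y $ l + (v $ l $ i) *\<^sub>R e i j) - h (y $ l))
        \<le> (\<Sum>l\<in>{l. l \<noteq> k}. v $ l $ i * (of_bool (a l = j) - of_bool (a l = i)))"
    proof (rule sum_mono)
      fix l
      have "2 * v $ l $ i \<le> B"
        using B[of i "{l}"] by (simp add: valuation_def)
      then show "h (y $ l + (v $ l $ i) *\<^sub>R e i j) - h (y $ l)
          \<le> v $ l $ i * (of_bool (a l = j) - of_bool (a l = i))"
        unfolding y_def using assms(3) by (simp only: vec_lambda_beta h_shift_axis_le)
    qed
    also have "\<dots> = valuation v i (X j - {k}) - valuation v i (X i - {k})"
      by (simp add: sum_owner_eq_valuation_diff a)
    finally have sum_le: "(\<Sum>l\<in>{l. l \<noteq> k}. h (y $ l + (v $ l $ i) *\<^sub>R e i j) - h (y $ l))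
        \<le> valuation v i (X j - {k}) - valuation v i (X i - {k})" .
    have h_y: "h (y $ k) = B"
      unfolding y_def using B_nonneg by (simp add: h_scaleR_axis)
    show ?thesis
    proof (cases "a k = j")
      \<comment> \<open>Here \<open>y $ k $ j\<close> cancels against \<open>h (y $ k)\<close>, so
        what remains is the EFX inequality; \<open>i\<close> does not own \<open>k\<close>, so
        removing \<open>k\<close> leaves \<open>X i\<close> unchanged.\<close>
      case True
      with \<open>i \<noteq> j\<close> have "X i - {k} = X i" "k \<in> X j"
        by (auto simp: a)
      with X have "valuation v i (X j - {k}) \<le> valuation v i (X i - {k})"
        by (simp add: EFX_allocation_def)
      moreover have "y $ k $ j = B"
        using True by (simp add: y_def axis_def)
      ultimately show ?thesis
        using sum_le h_y by simp
    next
      \<comment> \<open>The slack \<open>B\<close> between the entry 0 and the row maximum absorbs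
        the difference of valuations.\<close>
      case False
      then have "y $ k $ j = 0"
        by (simp add: y_def axis_def)
      then show ?thesis
        using sum_le h_y B[of i "X j - {k}"]
          val_nonneg[of i "X i - {k}"] val_nonneg[of i "X j - {k}"] by linarith
    qed
  qed
  then have "T v y = y"
    by (simp add: T_fixed_point_iff[OF assms(2)])
  then show "\<exists>y. T v y = y" ..
next
  assume "\<exists>y. T v y = y"
  then obtain y where y: "T v y = y" ..
  have "\<forall>l. \<exists>r. y $ l $ r = h (y $ l)"
    by (simp add: h_attained)
  \<comment> \<open>Any choice of maximisers works, so ties are broken arbitrarily.\<close>
  then obtain a where a: "\<And>l. y $ l $ a l = h (y $ l)"
    by metis
  have "valuation v i ({l. a l = a k} - {k}) \<le> valuation v i ({l. a l = i} - {k})"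
    if "i \<noteq> a k" for k i
  proof -
    have "valuation v i ({l. a l = a k} - {k}) - valuation v i ({l. a l = i} - {k})
        = (\<Sum>l\<in>{l. l \<noteq> k}. v $ l $ i * (of_bool (a l = a k) - of_bool (a l = i)))"
      by (simp add: sum_owner_eq_valuation_diff)
    also have "\<dots> \<le> (\<Sum>l\<in>{l. l \<noteq> k}. h (y $ l + (v $ l $ i) *\<^sub>R e i (a k)) - h (y $ l))"
      by (intro sum_mono h_shift_ge a)
    \<comment> \<open>This is the fixed-point condition at \<open>(k, a k)\<close>, where the entry
      of \<open>y\<close> is the row maximum and cancels.\<close>
    also have "\<dots> \<le> 0"
      using y[unfolded T_fixed_point_iff[OF assms(2)], rule_format, OF that, of k] a[of k]
      by simp
    finally show ?thesis by simp
  qed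
  then have "EFX_allocation v (\<lambda>j. {l. a l = j})"
    by (intro EFX_allocation_ownerI assms(3))
  then show "\<exists>X. EFX_allocation v X" by (rule exI[of "EFX_allocation v"])
qed

end
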